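(* Every existentially closed co-Brouwerian semilattice $L$ satisfies the Density 1 Axiom: for every $c\in L$ there exists $b\in L$, $b\neq 0$, such that $c\ll b$.
   Context: A co-Brouwerian semilattice (CBS) is a poset with least element $0$, binary joins $\vee$ and a difference $-$ characterized by $a-b\le c$ iff $a\le b\vee c$. $a\ll b$ means $a\le b$ and $b-a=b$. A CBS $L$ is existentially closed if for every CBS $B\supseteq L$ (superstructure in signature $(0,\vee,-)$), every existential sentence with parameters in $L$ true in $B$ is true in $L$. *)

theory Defs
  imports "HOL-Algebra.Lattice"
begin

section \<open>Co-Brouwerian semilattices\<close>

record 'a cbs = "'a gorder" +
  diff :: "'a \<Rightarrow> 'a \<Rightarrow> 'a" (infixl \<open>\<setminus>\<index>\<close> 65)

locale cbs = upper_semilattice L + weak_partial_order_bottom L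
  for L :: "('a, 'm) cbs_scheme" (structure) +
  assumes diff_closed [simp, intro]:
      "\<lbrakk>a \<in> carrier L; b \<in> carrier L\<rbrakk> \<Longrightarrow> a \<setminus> b \<in> carrier L"
    and diff_le_iff:
      "\<lbrakk>a \<in> carrier L; b \<in> carrier L; c \<in> carrier L\<rbrakk> \<Longrightarrow> a \<setminus> b \<sqsubseteq> c \<longleftrightarrow> a \<sqsubseteq> b \<squnion> c"

definition ll :: "('a, 'm) cbs_scheme \<Rightarrow> 'a \<Rightarrow> 'a \<Rightarrow> bool" (infix \<open>\<lless>\<index>\<close> 50) where
  "a \<lless>\<^bsub>L\<^esub> b \<longleftrightarrow> a \<sqsubseteq>\<^bsub>L\<^esub> b \<and> b \<setminus>\<^bsub>L\<^esub> a = b"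

text \<open>Embeddings for the signature \<open>(0, \<or>, -)\<close>; a superstructure of \<open>L\<close> is represented
  by an embedding of \<open>L\<close> into it.\<close>

definition cbs_embedding ::
    "('a \<Rightarrow> 'b) \<Rightarrow> ('a, 'm) cbs_scheme \<Rightarrow> ('b, 'k) cbs_scheme \<Rightarrow> bool" where
  "cbs_embedding f L B \<longleftrightarrow>
     f \<in> carrier L \<rightarrow> carrier B \<and> inj_on f (carrier L) \<and>
     f \<bottom>\<^bsub>L\<^esub> = \<bottom>\<^bsub>B\<^esub> \<and>
     (\<forall>a\<in>carrier L. \<forall>b\<in>carrier L.
        f (a \<squnion>\<^bsub>L\<^esub> b) = f a \<squnion>\<^bsub>B\<^esub> f b \<and> f (a \<setminus>\<^bsub>L\<^esub> b) = f a \<setminus>\<^bsub>B\<^esub> f b)"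


section \<open>Existential sentences with parameters\<close>

datatype (term_params: 'p) cbs_term =
    Var nat
  | Param 'p
  | Zero
  | Join "'p cbs_term" "'p cbs_term"
  | Diff "'p cbs_term" "'p cbs_term"

datatype (qf_params: 'p) cbs_qf =
    Eq "'p cbs_term" "'p cbs_term"
  | Neg "'p cbs_qf"
  | Conj "'p cbs_qf" "'p cbs_qf"
  | Disj "'p cbs_qf" "'p cbs_qf"

primrec term_vars :: "'p cbs_term \<Rightarrow> nat set" where
  "term_vars (Var i) = {i}"
| "term_vars (Param p) = {}"
| "term_vars Zero = {}"
| "term_vars (Join s t) = term_vars s \<union> term_vars t"
| "term_vars (Diff s t) = term_vars s \<union> term_vars t"

primrec qf_vars :: "'p cbs_qf \<Rightarrow> nat set" where
  "qf_vars (Eq s t) = term_vars s \<union> term_vars t"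
| "qf_vars (Neg \<psi>) = qf_vars \<psi>"
| "qf_vars (Conj \<psi> \<chi>) = qf_vars \<psi> \<union> qf_vars \<chi>"
| "qf_vars (Disj \<psi> \<chi>) = qf_vars \<psi> \<union> qf_vars \<chi>"

text \<open>In the semantics, \<open>f\<close> interprets the parameters and \<open>v\<close> the variables.\<close>

primrec term_val ::
    "('b, 'k) cbs_scheme \<Rightarrow> ('p \<Rightarrow> 'b) \<Rightarrow> (nat \<Rightarrow> 'b) \<Rightarrow> 'p cbs_term \<Rightarrow> 'b" where
  "term_val B f v (Var i) = v i"
| "term_val B f v (Param p) = f p"
| "term_val B f v Zero = \<bottom>\<^bsub>B\<^esub>"
| "term_val B f v (Join s t) = term_val B f v s \<squnion>\<^bsub>B\<^esub> term_val B f v t"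
| "term_val B f v (Diff s t) = term_val B f v s \<setminus>\<^bsub>B\<^esub> term_val B f v t"

primrec qf_true ::
    "('b, 'k) cbs_scheme \<Rightarrow> ('p \<Rightarrow> 'b) \<Rightarrow> (nat \<Rightarrow> 'b) \<Rightarrow> 'p cbs_qf \<Rightarrow> bool" where
  "qf_true B f v (Eq s t) \<longleftrightarrow> term_val B f v s = term_val B f v t"
| "qf_true B f v (Neg \<psi>) \<longleftrightarrow> \<not> qf_true B f v \<psi>"
| "qf_true B f v (Conj \<psi> \<chi>) \<longleftrightarrow> qf_true B f v \<psi> \<and> qf_true B f v \<chi>"
| "qf_true B f v (Disj \<psi> \<chi>) \<longleftrightarrow> qf_true B f v \<psi> \<or> qf_true B f v \<chi>"

text \<open>\<open>Ex n \<psi>\<close> stands for \<open>\<exists>x\<^sub>0 \<dots> x\<^sub>n\<^sub>-\<^sub>1. \<psi>\<close>.\<close>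

datatype 'p ex_formula = Ex nat "'p cbs_qf"

primrec ex_sentence_over :: "'p set \<Rightarrow> 'p ex_formula \<Rightarrow> bool" where
  "ex_sentence_over P (Ex n \<psi>) \<longleftrightarrow> qf_vars \<psi> \<subseteq> {..<n} \<and> qf_params \<psi> \<subseteq> P"

primrec ex_true :: "('b, 'k) cbs_scheme \<Rightarrow> ('p \<Rightarrow> 'b) \<Rightarrow> 'p ex_formula \<Rightarrow> bool" where
  "ex_true B f (Ex n \<psi>) \<longleftrightarrow> (\<exists>v. (\<forall>i<n. v i \<in> carrier B) \<and> qf_true B f v \<psi>)"


section \<open>Existentially closed co-Brouwerian semilattices\<close>

text \<open>HOL cannot quantify over all types inside a formula, so the superstructures range over
  those living on subsets of \<open>'a + nat\<close>. By the downward Loewenheim-Skolem argument this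
  loses nothing; see \<open>existentially_closed_any_type\<close> below.\<close>

definition existentially_closed :: "('a, 'm) cbs_scheme \<Rightarrow> bool" where
  "existentially_closed L \<longleftrightarrow> cbs L \<and>
     (\<forall>(B :: ('a + nat) cbs) f \<phi>.
        cbs B \<longrightarrow> cbs_embedding f L B \<longrightarrow> ex_sentence_over (carrier L) \<phi> \<longrightarrow>
        ex_true B f \<phi> \<longrightarrow> ex_true L (\<lambda>p. p) \<phi>)"

context cbs
begin

lemma join_least:
  assumes "x \<in> carrier L" "y \<in> carrier L" "z \<in> carrier L"
  shows "x \<squnion> y \<sqsubseteq> z \<longleftrightarrow> x \<sqsubseteq> z \<and> y \<sqsubseteq> z"
  using assms by (meson join_closed join_le join_left join_right le_trans)

end

lemma join_eqI:
  assumes "partial_order L" "x \<in> carrier L" "y \<in> carrier L" "s \<in> carrier L"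
    and "\<And>z. z \<in> carrier L \<Longrightarrow> s \<sqsubseteq>\<^bsub>L\<^esub> z \<longleftrightarrow> x \<sqsubseteq>\<^bsub>L\<^esub> z \<and> y \<sqsubseteq>\<^bsub>L\<^esub> z"
  shows "least L s (Upper L {x, y})" "x \<squnion>\<^bsub>L\<^esub> y = s"
proof -
  interpret partial_order L by fact
  show *: "least L s (Upper L {x, y})"
    using assms(2-) le_refl[OF assms(4)] unfolding least_def Upper_def by auto
  show "x \<squnion>\<^bsub>L\<^esub> y = s"
    unfolding join_def sup_def
    by (rule some_equality) (use * least_unique in auto)
qed

text \<open>The substructure of \<open>B\<close> on a closed set \<open>S\<close>, transported along an injection \<open>g\<close>.\<close>

lemma transported_substructure:
  fixes B :: "('b, 'k) cbs_scheme" and g :: "'b \<Rightarrow> 'c"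
  assumes "cbs B" and S: "S \<subseteq> carrier B" and g: "inj_on g S"
    and bot: "\<bottom>\<^bsub>B\<^esub> \<in> S"
    and cl: "\<And>x y. x \<in> S \<Longrightarrow> y \<in> S \<Longrightarrow> x \<squnion>\<^bsub>B\<^esub> y \<in> S \<and> x \<setminus>\<^bsub>B\<^esub> y \<in> S"
  obtains C :: "'c cbs" where "cbs C" "carrier C = g ` S" "\<bottom>\<^bsub>C\<^esub> = g \<bottom>\<^bsub>B\<^esub>"
    "\<And>x y. x \<in> S \<Longrightarrow> y \<in> S \<Longrightarrow> g x \<squnion>\<^bsub>C\<^esub> g y = g (x \<squnion>\<^bsub>B\<^esub> y) \<and> g x \<setminus>\<^bsub>C\<^esub> g y = g (x \<setminus>\<^bsub>B\<^esub> y)"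
proof -
  interpret B: cbs B by fact
  define h where "h = inv_into S g"
  have h: "h (g x) = x" if "x \<in> S" for x using that g by (simp add: h_def)
  define C :: "'c cbs" where "C = \<lparr>carrier = g ` S, eq = (=),
     le = (\<lambda>x y. h x \<sqsubseteq>\<^bsub>B\<^esub> h y), diff = (\<lambda>x y. g (h x \<setminus>\<^bsub>B\<^esub> h y))\<rparr>"
  have car: "carrier C = g ` S" by (simp add: C_def)
  have le: "g x \<sqsubseteq>\<^bsub>C\<^esub> g y \<longleftrightarrow> x \<sqsubseteq>\<^bsub>B\<^esub> y" if "x \<in> S" "y \<in> S" for x y
    using that h by (simp add: C_def)
  have inB: "x \<in> carrier B" if "x \<in> S" for x using that S by auto
  have po: "partial_order C"
  proof unfold_locales
    show "(.=\<^bsub>C\<^esub>) = (=)" by (simp add: C_def)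
    fix x y z assume xyz: "x \<in> carrier C" "y \<in> carrier C" "z \<in> carrier C"
      "x \<sqsubseteq>\<^bsub>C\<^esub> y" "y \<sqsubseteq>\<^bsub>C\<^esub> z"
    then obtain a b c where "a \<in> S" "b \<in> S" "c \<in> S" "x = g a" "y = g b" "z = g c"
      by (auto simp: car)
    with xyz show "x \<sqsubseteq>\<^bsub>C\<^esub> z" by (metis le inB B.le_trans)
  next
    fix x y assume xy: "x \<in> carrier C" "y \<in> carrier C" "x \<sqsubseteq>\<^bsub>C\<^esub> y" "y \<sqsubseteq>\<^bsub>C\<^esub> x"
    then obtain a b where "a \<in> S" "b \<in> S" "x = g a" "y = g b" by (auto simp: car)
    with xy have "x = y" by (metis le inB B.le_antisym)
    then show "x .=\<^bsub>C\<^esub> y" by (simp add: C_def)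
  next
    fix x assume "x \<in> carrier C"
    then show "x \<sqsubseteq>\<^bsub>C\<^esub> x" by (metis le inB B.le_refl car imageE)
  qed (auto simp: C_def)
  interpret C: partial_order C by (rule po)
  have J: "least C (g (x \<squnion>\<^bsub>B\<^esub> y)) (Upper C {g x, g y})" "g x \<squnion>\<^bsub>C\<^esub> g y = g (x \<squnion>\<^bsub>B\<^esub> y)"
    if "x \<in> S" "y \<in> S" for x y
  proof -
    have "g (x \<squnion>\<^bsub>B\<^esub> y) \<sqsubseteq>\<^bsub>C\<^esub> z \<longleftrightarrow> g x \<sqsubseteq>\<^bsub>C\<^esub> z \<and> g y \<sqsubseteq>\<^bsub>C\<^esub> z" if "z \<in> carrier C" for z
      using that \<open>x \<in> S\<close> \<open>y \<in> S\<close> cl by (auto simp: car le B.join_least inB)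
    from join_eqI[OF po _ _ _ this] that cl
    show "least C (g (x \<squnion>\<^bsub>B\<^esub> y)) (Upper C {g x, g y})" "g x \<squnion>\<^bsub>C\<^esub> g y = g (x \<squnion>\<^bsub>B\<^esub> y)"
      by (auto simp: car)
  qed
  have D: "g x \<setminus>\<^bsub>C\<^esub> g y = g (x \<setminus>\<^bsub>B\<^esub> y)" if "x \<in> S" "y \<in> S" for x y
    using that h by (simp add: C_def)
  have lb: "least C (g \<bottom>\<^bsub>B\<^esub>) (carrier C)"
    unfolding least_def using bot by (auto simp: car le inB)
  have cb: "cbs C"
  proof unfold_locales
    show "\<exists>x. least C x (carrier C)" using lb by blast
    fix x y assume "x \<in> carrier C" "y \<in> carrier C"
    then obtain a b where ab: "a \<in> S" "b \<in> S" "x = g a" "y = g b" by (auto simp: car)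
    then show "\<exists>s. least C s (Upper C {x, y})" using J(1) by blast
    show "x \<setminus>\<^bsub>C\<^esub> y \<in> carrier C" using ab D cl by (auto simp: car)
    fix z assume "z \<in> carrier C"
    then obtain c where "c \<in> S" "z = g c" by (auto simp: car)
    with ab show "x \<setminus>\<^bsub>C\<^esub> y \<sqsubseteq>\<^bsub>C\<^esub> z \<longleftrightarrow> x \<sqsubseteq>\<^bsub>C\<^esub> y \<squnion>\<^bsub>C\<^esub> z"
      using cl by (simp add: D J(2) le B.diff_le_iff inB)
  qed
  have "\<bottom>\<^bsub>C\<^esub> = g \<bottom>\<^bsub>B\<^esub>"
    unfolding bottom_def[of C] by (rule some_equality) (use lb C.least_unique in auto)
  with that[OF cb car] J(2) D show thesis by blast
qed

text \<open>The hypothesis of \<open>existentially_closed\<close> extends to superstructures on every type.\<close>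

theorem existentially_closed_any_type:
  includes cardinal_syntax
  fixes L :: "('a, 'm) cbs_scheme" and B :: "('b, 'k) cbs_scheme"
  assumes ec: "existentially_closed L" and "cbs B" and emb: "cbs_embedding f L B"
    and sent: "ex_sentence_over (carrier L) \<phi>" and true: "ex_true B f \<phi>"
  shows "ex_true L (\<lambda>p. p) \<phi>"
proof -
  interpret B: cbs B by fact
  interpret L: cbs L using ec by (simp add: existentially_closed_def)
  obtain n \<psi> where \<phi>: "\<phi> = Ex n \<psi>" by (cases \<phi>)
  obtain v where v: "\<And>i. i < n \<Longrightarrow> v i \<in> carrier B" "qf_true B f v \<psi>"
    using true \<phi> by auto
  define T where "T = (\<lambda>k. ((\<lambda>S. S \<union> (\<lambda>(x, y). x \<squnion>\<^bsub>B\<^esub> y) ` (S \<times> S) \<union> (\<lambda>(x, y). x \<setminus>\<^bsub>B\<^esub> y) ` (S \<times> S)) ^^ k)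
     (f ` carrier L \<union> {\<bottom>\<^bsub>B\<^esub>} \<union> v ` {..<n}))"
  have T0: "T 0 = f ` carrier L \<union> {\<bottom>\<^bsub>B\<^esub>} \<union> v ` {..<n}" by (simp add: T_def)
  have TS: "T (Suc k) = T k \<union> (\<lambda>(x, y). x \<squnion>\<^bsub>B\<^esub> y) ` (T k \<times> T k) \<union> (\<lambda>(x, y). x \<setminus>\<^bsub>B\<^esub> y) ` (T k \<times> T k)" for k
    by (simp add: T_def)
  define S where "S = (\<Union>k. T k)"
  have mono: "T k \<subseteq> T l" if "k \<le> l" for k l
    using that by (induction l rule: dec_induct) (auto simp: TS)
  have TB: "T k \<subseteq> carrier B" for k
  proof (induction k)
    case 0
    then show ?case using emb v by (auto simp: T0 cbs_embedding_def)
  next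
    case (Suc k)
    then show ?case by (auto simp: TS subset_iff)
  qed
  then have SB: "S \<subseteq> carrier B" by (auto simp: S_def)
  have S0: "f ` carrier L \<subseteq> S" "\<bottom>\<^bsub>B\<^esub> \<in> S" "\<And>i. i < n \<Longrightarrow> v i \<in> S"
    using T0 by (auto simp: S_def)
  have cl: "x \<squnion>\<^bsub>B\<^esub> y \<in> S \<and> x \<setminus>\<^bsub>B\<^esub> y \<in> S" if xy: "x \<in> S" "y \<in> S" for x y
  proof -
    obtain k l where "x \<in> T k" "y \<in> T l" using xy by (auto simp: S_def)
    then have "x \<in> T (max k l)" "y \<in> T (max k l)" using mono by (meson max.cobounded1 max.cobounded2 subsetD)+
    then have "x \<squnion>\<^bsub>B\<^esub> y \<in> T (Suc (max k l))" "x \<setminus>\<^bsub>B\<^esub> y \<in> T (Suc (max k l))" by (auto simp: TS)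
    then show ?thesis by (auto simp: S_def)
  qed
  let ?U = "UNIV :: ('a + nat) set"
  have infU: "infinite ?U" by (simp add: finite_Plus_UNIV_iff)
  then have infF: "infinite (Field |?U| )" by (simp add: Field_card_of)
  have Un_le: "|A \<union> A'| \<le>o |?U|" if "|A| \<le>o |?U|" "|A'| \<le>o |?U|" for A A' :: "'b set"
    by (rule card_of_Un_ordLeq_infinite_Field[OF infF that card_of_Card_order])
  have cardT: "|T k| \<le>o |?U|" for k
  proof (induction k)
    case 0
    have "|f ` carrier L| \<le>o |?U|"
      by (rule ordLeq_transitive[OF card_of_image])
         (rule card_of_ordLeqI[of Inl], auto simp: inj_on_def)
    moreover have "|{\<bottom>\<^bsub>B\<^esub>} \<union> v ` {..<n}| \<le>o |?U|"
      using ordLeq_total[OF card_of_Well_order card_of_Well_order] card_of_ordLeq_finite infU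
      by (metis finite.emptyI finite_imageI finite_insert finite_Un finite_lessThan)
    ultimately show ?case
      unfolding T0 Un_assoc by (rule Un_le)
  next
    case (Suc k)
    have "|T k \<times> T k| \<le>o |?U|"
      by (rule card_of_Times_ordLeq_infinite_Field[OF infF Suc Suc card_of_Card_order])
    then have "|h ` (T k \<times> T k)| \<le>o |?U|" for h :: "'b \<times> 'b \<Rightarrow> 'b"
      using card_of_image ordLeq_transitive by blast
    then show ?case unfolding TS
      by (intro Un_le Suc)
  qed
  have "|S| \<le>o |?U|" unfolding S_def
  proof (rule card_of_UNION_ordLeq_infinite[OF infU])
    show "|UNIV :: nat set| \<le>o |?U|"
      by (rule card_of_ordLeqI[of Inr]) (auto simp: inj_on_def)
  qed (use cardT in auto)
  then obtain g :: "'b \<Rightarrow> 'a + nat" where g: "inj_on g S"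
    by (metis card_of_ordLeq)
  obtain C :: "('a + nat) cbs" where C: "cbs C" "carrier C = g ` S" "\<bottom>\<^bsub>C\<^esub> = g \<bottom>\<^bsub>B\<^esub>"
    "\<And>x y. x \<in> S \<Longrightarrow> y \<in> S \<Longrightarrow> g x \<squnion>\<^bsub>C\<^esub> g y = g (x \<squnion>\<^bsub>B\<^esub> y) \<and> g x \<setminus>\<^bsub>C\<^esub> g y = g (x \<setminus>\<^bsub>B\<^esub> y)"
    using transported_substructure[OF \<open>cbs B\<close> SB g S0(2) cl] by blast
  have fS: "f a \<in> S" if "a \<in> carrier L" for a using S0(1) that by auto
  have "inj_on (g \<circ> f) (carrier L)"
    using emb S0(1) g by (auto simp: cbs_embedding_def intro: comp_inj_on inj_on_subset)
  then have embC: "cbs_embedding (g \<circ> f) L C"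
    using emb fS C by (auto simp: cbs_embedding_def)
  have tv: "term_val B f v t \<in> S \<and> term_val C (g \<circ> f) (g \<circ> v) t = g (term_val B f v t)"
    if "term_vars t \<subseteq> {..<n}" "term_params t \<subseteq> carrier L" for t
    using that by (induction t) (use S0 fS cl C in auto)
  have qf: "qf_true C (g \<circ> f) (g \<circ> v) \<chi> \<longleftrightarrow> qf_true B f v \<chi>"
    if "qf_vars \<chi> \<subseteq> {..<n}" "qf_params \<chi> \<subseteq> carrier L" for \<chi>
    using that by (induction \<chi>) (auto simp: tv inj_on_eq_iff[OF g])
  have "ex_true C (g \<circ> f) \<phi>"
    unfolding \<phi> ex_true.simps using qf sent v S0(3) C(2)
    by (intro exI[of _ "g \<circ> v"]) (auto simp: \<phi>)
  then show ?thesis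
    using ec C(1) embC sent unfolding existentially_closed_def by blast
qed

end

theory Submission
  imports Defs
begin

text \<open>Adjoining a new greatest element \<open>\<infinity>\<close> to \<open>L\<close> gives a superstructure in which
  \<open>\<infinity> - c = \<infinity>\<close> for every \<open>c\<close> in \<open>L\<close>. Hence \<open>\<exists>x. x \<noteq> 0 \<and> c \<or> x = x \<and> x - c = x\<close> holds
  there, and so it holds in an existentially closed \<open>L\<close>.\<close>

definition adjoin_top :: "('a, 'm) cbs_scheme \<Rightarrow> 'a option cbs" where
  "adjoin_top L = \<lparr>carrier = insert None (Some ` carrier L), eq = (=),
     le = (\<lambda>x y. case y of None \<Rightarrow> True
        | Some b \<Rightarrow> (case x of None \<Rightarrow> False | Some a \<Rightarrow> a \<sqsubseteq>\<^bsub>L\<^esub> b)),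
     diff = (\<lambda>x y. case y of None \<Rightarrow> Some \<bottom>\<^bsub>L\<^esub>
        | Some b \<Rightarrow> map_option (\<lambda>a. a \<setminus>\<^bsub>L\<^esub> b) x)\<rparr>"

lemma adjoin_top_simps [simp]:
  "carrier (adjoin_top L) = insert None (Some ` carrier L)"
  "x .=\<^bsub>adjoin_top L\<^esub> y \<longleftrightarrow> x = y"
  "x \<sqsubseteq>\<^bsub>adjoin_top L\<^esub> None"
  "\<not> None \<sqsubseteq>\<^bsub>adjoin_top L\<^esub> Some b"
  "Some a \<sqsubseteq>\<^bsub>adjoin_top L\<^esub> Some b \<longleftrightarrow> a \<sqsubseteq>\<^bsub>L\<^esub> b"
  "x \<setminus>\<^bsub>adjoin_top L\<^esub> None = Some \<bottom>\<^bsub>L\<^esub>"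
  "None \<setminus>\<^bsub>adjoin_top L\<^esub> Some b = None"
  "Some a \<setminus>\<^bsub>adjoin_top L\<^esub> Some b = Some (a \<setminus>\<^bsub>L\<^esub> b)"
  by (simp_all add: adjoin_top_def)

lemma partial_order_adjoin_top:
  assumes "partial_order L"
  shows "partial_order (adjoin_top L)"
proof -
  interpret partial_order L by fact
  show ?thesis
    by unfold_locales (auto simp: fun_eq_iff intro: le_antisym le_trans)
qed

context cbs
begin

text \<open>\<open>None\<close> lies above everything and below no \<open>Some b\<close>, so any
  pair containing \<open>None\<close> has only \<open>None\<close> as an upper bound. The
  \<open>least\<close> form yields existence of joins; the equation evaluates the choice made in the
  definition of the join.\<close>

lemma join_adjoin_top:
  assumes "x \<in> carrier (adjoin_top L)" "y \<in> carrier (adjoin_top L)"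
  defines "s \<equiv> (case (x, y) of (Some a, Some b) \<Rightarrow> Some (a \<squnion> b) | _ \<Rightarrow> None)"
  shows "least (adjoin_top L) s (Upper (adjoin_top L) {x, y})" "x \<squnion>\<^bsub>adjoin_top L\<^esub> y = s"
proof -
  have po: "partial_order (adjoin_top L)"
    by (intro partial_order_adjoin_top partial_order_axioms)
  have s: "s \<in> carrier (adjoin_top L)"
    using assms by auto
  have "s \<sqsubseteq>\<^bsub>adjoin_top L\<^esub> z \<longleftrightarrow> x \<sqsubseteq>\<^bsub>adjoin_top L\<^esub> z \<and> y \<sqsubseteq>\<^bsub>adjoin_top L\<^esub> z"
    if "z \<in> carrier (adjoin_top L)" for z
    using that assms by (auto simp: join_least)
  from join_eqI[OF po assms(1,2) s this]
  show "least (adjoin_top L) s (Upper (adjoin_top L) {x, y})" "x \<squnion>\<^bsub>adjoin_top L\<^esub> y = s"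
    by auto
qed

lemma join_adjoin_top_simps:
  "x \<in> carrier (adjoin_top L) \<Longrightarrow> x \<squnion>\<^bsub>adjoin_top L\<^esub> None = None"
  "x \<in> carrier (adjoin_top L) \<Longrightarrow> None \<squnion>\<^bsub>adjoin_top L\<^esub> x = None"
  "a \<in> carrier L \<Longrightarrow> b \<in> carrier L \<Longrightarrow> Some a \<squnion>\<^bsub>adjoin_top L\<^esub> Some b = Some (a \<squnion> b)"
  by (auto simp: join_adjoin_top(2) split: option.splits)

lemma least_adjoin_top: "least (adjoin_top L) (Some \<bottom>) (carrier (adjoin_top L))"
  unfolding least_def by auto

text \<open>For the difference law: if y is \<infinity>, both sides hold, since x - y = 0 and y
  \<or> z = \<infinity>. If only x is \<infinity>, both sides say z = \<infinity>, since joins of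
  old elements stay old. Otherwise z = \<infinity> makes both sides true, and an old z reduces to
  the law in \<open>L\<close>.\<close>

lemma cbs_adjoin_top: "cbs (adjoin_top L)"
proof -
  interpret A: partial_order "adjoin_top L"
    by (intro partial_order_adjoin_top partial_order_axioms)
  show ?thesis
  proof unfold_locales
    show "\<exists>x. least (adjoin_top L) x (carrier (adjoin_top L))"
      using least_adjoin_top by blast
    fix x y assume xy: "x \<in> carrier (adjoin_top L)" "y \<in> carrier (adjoin_top L)"
    then show "\<exists>s. least (adjoin_top L) s (Upper (adjoin_top L) {x, y})"
      using join_adjoin_top(1) by blast
    show "x \<setminus>\<^bsub>adjoin_top L\<^esub> y \<in> carrier (adjoin_top L)"
      using xy by auto
    fix z assume "z \<in> carrier (adjoin_top L)"
    with xy show "x \<setminus>\<^bsub>adjoin_top L\<^esub> y \<sqsubseteq>\<^bsub>adjoin_top L\<^esub> z \<longleftrightarrow>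
        x \<sqsubseteq>\<^bsub>adjoin_top L\<^esub> y \<squnion>\<^bsub>adjoin_top L\<^esub> z"
      by (auto simp: join_adjoin_top_simps diff_le_iff)
  qed
qed

text \<open>Bottom is defined by choice, so uniqueness of least elements is what pins down its
  value.\<close>

lemma bottom_adjoin_top: "\<bottom>\<^bsub>adjoin_top L\<^esub> = Some \<bottom>"
proof -
  interpret A: cbs "adjoin_top L" by (rule cbs_adjoin_top)
  show ?thesis
    unfolding bottom_def[of "adjoin_top L"]
    by (rule some_equality) (use least_adjoin_top A.least_unique in auto)
qed

lemma cbs_embedding_adjoin_top: "cbs_embedding Some L (adjoin_top L)"
  by (auto simp: cbs_embedding_def bottom_adjoin_top join_adjoin_top_simps)

end

theorem theorem4p7:
  fixes L :: "('a, 'm) cbs_scheme" (structure)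
  assumes "cbs L"
    and "existentially_closed L"
  shows "\<forall>c\<in>carrier L. \<exists>b\<in>carrier L. b \<noteq> \<bottom> \<and> c \<lless> b"
proof
  interpret cbs L by fact
  fix c assume c: "c \<in> carrier L"
  \<comment> \<open>The signature has no order symbol, so c \<le> x is expressed by the equation c
    \<or> x = x.\<close>
  define \<phi> where "\<phi> = Ex 1 (Conj (Neg (Eq (Var 0) Zero))
    (Conj (Eq (Join (Param c) (Var 0)) (Var 0)) (Eq (Diff (Var 0) (Param c)) (Var 0))))"
  have "ex_sentence_over (carrier L) \<phi>"
    using c by (simp add: \<phi>_def)
  \<comment> \<open>The witness is \<infinity>, i.e. \<open>None\<close>. It differs from the bottom
    \<open>Some \<bottom>\<close>, absorbs c in joins, and is unchanged by subtracting c.\<close>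
  moreover have "ex_true (adjoin_top L) Some \<phi>"
    using c by (auto simp: \<phi>_def bottom_adjoin_top join_adjoin_top_simps intro!: exI[of _ "\<lambda>_. None"])
  \<comment> \<open>The extension lives on \<open>'a option\<close> rather than
    \<open>'a + nat\<close>, hence the transfer to arbitrary carrier types.\<close>
  ultimately have "ex_true L (\<lambda>p. p) \<phi>"
    by (rule existentially_closed_any_type[OF assms(2) cbs_adjoin_top cbs_embedding_adjoin_top])
  then obtain b where "b \<in> carrier L" "b \<noteq> \<bottom>" "c \<squnion> b = b" "b \<setminus> c = b"
    by (auto simp: \<phi>_def)
  \<comment> \<open>The equation c \<or> b = b is turned back into the order relation, as c \<le> c
    \<or> b.\<close>
  moreover from this c have "c \<sqsubseteq> b"
    by (metis join_left)
  ultimately show "\<exists>b\<in>carrier L. b \<noteq> \<bottom> \<and> c \<lless> b"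
    by (auto simp: ll_def)
qed

end
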